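(* Let $A$ be a noetherian ring containing the field $\mathbb{Q}$ of rational numbers. Let $\overline{A}$ be the integral closure of $A$ in its total quotient ring. Then $$\mathrm{d}_{A}(\overline{A})=\sup\{\mathrm{rn}(I)\mid I\text{ a regular ideal of }A\text{ having a principal reduction}\}+1,$$ where both sides are allowed to be infinite.
   Context: All rings are commutative with identity. An ideal is regular if it contains a non zero divisor of $A$. An ideal $J\subseteq I$ is a reduction of $I$ if $I^{n+1}=JI^{n}$ for some integer $n\ge 0$; the least such $n$ is the $J$-reduction number $\mathrm{rn}_J(I)$. A principal reduction is a reduction which is a principal ideal. If $I$ is a regular ideal having a principal reduction, it is a known fact that $\mathrm{rn}_J(I)$ is the same for every principal reduction $J$ of $I$; this common value is denoted $\mathrm{rn}(I)$. Integral degree: if $A\subseteq B$ is a ring extension and $b\in B$ is integral over $A$, then $\mathrm{id}_A(b)$ is the least $n\ge1$ such that $b$ satisfies a monic polynomial equation of degree $n$ with coefficients in $A$. If $A\subseteq B$ is an integral extension, $\mathrm{d}_A(B)=\sup\{\mathrm{id}_A(b)\mid b\in B\}$ (possibly $\infty$). *)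

theory Defs
  imports "HOL-Computational_Algebra.Polynomial" "HOL-Library.Extended_Nat"
begin

text \<open>
  A commutative ring is a type of class \<open>comm_ring_1\<close>. This class only excludes the zero ring.
\<close>

subsection \<open>Ideals\<close>

text \<open>An ideal is a submodule of the ring over itself, and generated ideals are spans.\<close>

definition ring_ideal :: "'a::comm_ring_1 set \<Rightarrow> bool" where
  "ring_ideal I \<longleftrightarrow> module.subspace (*) I"

definition ideal_gen :: "'a::comm_ring_1 set \<Rightarrow> 'a set" where
  "ideal_gen S = module.span (*) S"

definition noetherian_type :: "'a::comm_ring_1 itself \<Rightarrow> bool" where
  "noetherian_type _ \<longleftrightarrow> (\<forall>I::'a set. ring_ideal I \<longrightarrow> (\<exists>F. finite F \<and> I = ideal_gen F))"

definition ideal_mult :: "'a::comm_ring_1 set \<Rightarrow> 'a set \<Rightarrow> 'a set" where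
  "ideal_mult I J = ideal_gen {x * y | x y. x \<in> I \<and> y \<in> J}"

primrec ideal_power :: "'a::comm_ring_1 set \<Rightarrow> nat \<Rightarrow> 'a set" where
  "ideal_power I 0 = UNIV"
| "ideal_power I (Suc n) = ideal_mult I (ideal_power I n)"

definition nonzerodivisor :: "'a::comm_ring_1 \<Rightarrow> bool" where
  "nonzerodivisor x \<longleftrightarrow> (\<forall>y. x * y = 0 \<longrightarrow> y = 0)"

definition regular_ideal :: "'a::comm_ring_1 set \<Rightarrow> bool" where
  "regular_ideal I \<longleftrightarrow> ring_ideal I \<and> (\<exists>x\<in>I. nonzerodivisor x)"


subsection \<open>Reductions and reduction numbers\<close>

definition reduction_of :: "'a::comm_ring_1 set \<Rightarrow> 'a set \<Rightarrow> bool" where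
  "reduction_of J I \<longleftrightarrow> ring_ideal J \<and> ring_ideal I \<and> J \<subseteq> I \<and>
     (\<exists>n. ideal_power I (n + 1) = ideal_mult J (ideal_power I n))"

definition reduction_number_wrt :: "'a::comm_ring_1 set \<Rightarrow> 'a set \<Rightarrow> nat" where
  "reduction_number_wrt J I = (LEAST n. ideal_power I (n + 1) = ideal_mult J (ideal_power I n))"

definition principal_reduction_of :: "'a::comm_ring_1 set \<Rightarrow> 'a set \<Rightarrow> bool" where
  "principal_reduction_of J I \<longleftrightarrow> reduction_of J I \<and> (\<exists>a. J = ideal_gen {a})"

text \<open>
  The common value of the reduction numbers of all principal reductions; only meaningful for a
  regular ideal that has a principal reduction.
\<close>

definition reduction_number :: "'a::comm_ring_1 set \<Rightarrow> nat" where
  "reduction_number I =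
     (THE r. \<forall>J. principal_reduction_of J I \<longrightarrow> reduction_number_wrt J I = r)"


subsection \<open>Integral degree\<close>

text \<open>
  A ring extension is given by an injective ring homomorphism \<open>h\<close> from the base ring to the
  extension ring, through which the coefficients of polynomials are mapped.
\<close>

definition monic_root_of_degree ::
    "('a::comm_ring_1 \<Rightarrow> 'b::comm_ring_1) \<Rightarrow> 'b \<Rightarrow> nat \<Rightarrow> bool" where
  "monic_root_of_degree h b n \<longleftrightarrow>
     (\<exists>p. lead_coeff p = 1 \<and> degree p = n \<and> poly (map_poly h p) b = 0)"

definition integral_over :: "('a::comm_ring_1 \<Rightarrow> 'b::comm_ring_1) \<Rightarrow> 'b \<Rightarrow> bool" where
  "integral_over h b \<longleftrightarrow> (\<exists>n\<ge>1. monic_root_of_degree h b n)"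

definition integral_degree :: "('a::comm_ring_1 \<Rightarrow> 'b::comm_ring_1) \<Rightarrow> 'b \<Rightarrow> nat" where
  "integral_degree h b = (LEAST n. n \<ge> 1 \<and> monic_root_of_degree h b n)"

text \<open>
  The intermediate ring \<open>B\<close> is a subset of the target of \<open>h\<close>; the value is only meaningful if all
  elements of \<open>B\<close> are integral.
\<close>

definition extension_integral_degree ::
    "('a::comm_ring_1 \<Rightarrow> 'b::comm_ring_1) \<Rightarrow> 'b set \<Rightarrow> enat" where
  "extension_integral_degree h B = (SUP b\<in>B. enat (integral_degree h b))"

definition integral_closure :: "('a::comm_ring_1 \<Rightarrow> 'b::comm_ring_1) \<Rightarrow> 'b set" where
  "integral_closure h = {b. integral_over h b}"


subsection \<open>The total quotient ring\<close>

lemma nonzerodivisor_1 [simp]: "nonzerodivisor 1"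
  by (simp add: nonzerodivisor_def)

lemma nonzerodivisor_mult [simp]:
  "nonzerodivisor x \<Longrightarrow> nonzerodivisor y \<Longrightarrow> nonzerodivisor (x * y)"
  unfolding nonzerodivisor_def mult.assoc by blast

lemma nonzerodivisor_cancel:
  assumes "nonzerodivisor x" and "x * y = x * z"
  shows "y = z"
proof -
  have "x * (y - z) = 0"
    using assms(2) by (simp add: right_diff_distrib)
  then show ?thesis
    using assms(1) unfolding nonzerodivisor_def by (metis eq_iff_diff_eq_0)
qed

definition tqrel :: "'a::comm_ring_1 \<times> 'a \<Rightarrow> 'a \<times> 'a \<Rightarrow> bool" where
  "tqrel x y \<longleftrightarrow> nonzerodivisor (snd x) \<and> nonzerodivisor (snd y) \<and> fst x * snd y = fst y * snd x"

lemma part_equivp_tqrel: "part_equivp (tqrel :: 'a::comm_ring_1 \<times> 'a \<Rightarrow> _)"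
proof (rule part_equivpI)
  show "\<exists>x::'a \<times> 'a. tqrel x x"
    by (rule exI[of _ "(0, 1)"]) (simp add: tqrel_def)
  show "symp (tqrel :: 'a \<times> 'a \<Rightarrow> _)"
    by (auto simp: symp_def tqrel_def)
  show "transp (tqrel :: 'a \<times> 'a \<Rightarrow> _)"
  proof (rule transpI)
    fix x y z :: "'a \<times> 'a"
    assume xy: "tqrel x y" and yz: "tqrel y z"
    have e: "fst x * snd y = fst y * snd x" "fst y * snd z = fst z * snd y"
      using xy yz by (simp_all only: tqrel_def)
    have "snd y * (fst x * snd z) = (fst x * snd y) * snd z"
      by (simp only: ac_simps)
    also have "\<dots> = (fst y * snd z) * snd x"
      unfolding e(1) by (simp only: ac_simps)
    also have "\<dots> = snd y * (fst z * snd x)"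
      unfolding e(2) by (simp only: ac_simps)
    finally have "fst x * snd z = fst z * snd x"
      by (rule nonzerodivisor_cancel[rotated]) (use xy in \<open>simp add: tqrel_def\<close>)
    then show "tqrel x z"
      using xy yz by (simp add: tqrel_def)
  qed
qed

quotient_type (overloaded) 'a total_quotient = "'a::comm_ring_1 \<times> 'a" / partial: tqrel
  by (rule part_equivp_tqrel)

instantiation total_quotient :: (comm_ring_1) comm_ring_1
begin

lift_definition zero_total_quotient :: "'a total_quotient" is "(0, 1)"
  by (simp add: tqrel_def)

lift_definition one_total_quotient :: "'a total_quotient" is "(1, 1)"
  by (simp add: tqrel_def)

lift_definition plus_total_quotient ::
    "'a total_quotient \<Rightarrow> 'a total_quotient \<Rightarrow> 'a total_quotient"
  is "\<lambda>x y. (fst x * snd y + fst y * snd x, snd x * snd y)"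
proof -
  fix x x' y y' :: "'a \<times> 'a"
  assume "tqrel x x'" "tqrel y y'"
  then have nz: "nonzerodivisor (snd x)" "nonzerodivisor (snd x')"
      "nonzerodivisor (snd y)" "nonzerodivisor (snd y')"
    and e: "fst x * snd x' = fst x' * snd x" "fst y * snd y' = fst y' * snd y"
    by (auto simp: tqrel_def)
  have "(fst x * snd y + fst y * snd x) * (snd x' * snd y')
      = (fst x * snd x') * (snd y * snd y') + (fst y * snd y') * (snd x * snd x')"
    by (simp add: algebra_simps)
  also have "\<dots> = (fst x' * snd y' + fst y' * snd x') * (snd x * snd y)"
    unfolding e by (simp add: algebra_simps)
  finally show "tqrel (fst x * snd y + fst y * snd x, snd x * snd y)
      (fst x' * snd y' + fst y' * snd x', snd x' * snd y')"
    using nz by (simp add: tqrel_def)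
qed

lift_definition uminus_total_quotient :: "'a total_quotient \<Rightarrow> 'a total_quotient"
  is "\<lambda>x. (- fst x, snd x)"
  by (simp add: tqrel_def)

definition minus_total_quotient ::
    "'a total_quotient \<Rightarrow> 'a total_quotient \<Rightarrow> 'a total_quotient" where
  "minus_total_quotient x y = x + - y"

lift_definition times_total_quotient ::
    "'a total_quotient \<Rightarrow> 'a total_quotient \<Rightarrow> 'a total_quotient"
  is "\<lambda>x y. (fst x * fst y, snd x * snd y)"
proof -
  fix x x' y y' :: "'a \<times> 'a"
  assume "tqrel x x'" "tqrel y y'"
  then have nz: "nonzerodivisor (snd x)" "nonzerodivisor (snd x')"
      "nonzerodivisor (snd y)" "nonzerodivisor (snd y')"
    and e: "fst x * snd x' = fst x' * snd x" "fst y * snd y' = fst y' * snd y"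
    by (auto simp: tqrel_def)
  have "(fst x * fst y) * (snd x' * snd y') = (fst x * snd x') * (fst y * snd y')"
    by (simp add: ac_simps)
  also have "\<dots> = (fst x' * fst y') * (snd x * snd y)"
    unfolding e by (simp add: ac_simps)
  finally show "tqrel (fst x * fst y, snd x * snd y) (fst x' * fst y', snd x' * snd y')"
    using nz by (simp add: tqrel_def)
qed

instance
proof
  fix x y z :: "'a total_quotient"
  show "x * y * z = x * (y * z)"
    by transfer (simp add: tqrel_def algebra_simps)
  show "x * y = y * x"
    by transfer (simp add: tqrel_def algebra_simps)
  show "1 * x = x"
    by transfer (simp add: tqrel_def)
  show "x + y + z = x + (y + z)"
    by transfer (simp add: tqrel_def algebra_simps)
  show "x + y = y + x"
    by transfer (simp add: tqrel_def algebra_simps)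
  show "0 + x = x"
    by transfer (simp add: tqrel_def)
  show "- x + x = 0"
    by transfer (simp add: tqrel_def algebra_simps)
  show "x - y = x + - y"
    by (rule minus_total_quotient_def)
  show "(x + y) * z = x * z + y * z"
    by transfer (simp add: tqrel_def algebra_simps)
  show "(0 :: 'a total_quotient) \<noteq> 1"
    by transfer (simp add: tqrel_def)
qed

end

lift_definition to_total_quotient :: "'a::comm_ring_1 \<Rightarrow> 'a total_quotient" is "\<lambda>a. (a, 1)"
  by (simp add: tqrel_def)

lemma to_total_quotient_hom:
  "to_total_quotient 0 = 0"
  "to_total_quotient 1 = 1"
  "to_total_quotient (x + y) = to_total_quotient x + to_total_quotient y"
  "to_total_quotient (x * y) = to_total_quotient x * to_total_quotient y"
  by (transfer, simp add: tqrel_def)+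

lemma inj_to_total_quotient: "inj to_total_quotient"
  by (rule injI, transfer) (simp add: tqrel_def)

lemma to_total_quotient_dvd_1:
  fixes s :: "'a::comm_ring_1"
  assumes "nonzerodivisor s"
  shows "to_total_quotient s dvd 1"
proof -
  have "\<exists>q. to_total_quotient s * q = 1"
    using assms
  proof transfer
    fix s :: 'a
    assume s: "nonzerodivisor s"
    show "\<exists>q\<in>{q. tqrel q q}. tqrel (fst (s, 1) * fst q, snd (s, 1) * snd q) (1, 1)"
      by (rule bexI[of _ "(1, s)"]) (use s in \<open>simp_all add: tqrel_def\<close>)
  qed
  then obtain q where "to_total_quotient s * q = 1" ..
  then show ?thesis by (rule dvdI[OF sym])
qed

lemma total_quotient_fraction:
  fixes q :: "'a::comm_ring_1 total_quotient"
  shows "\<exists>a s. nonzerodivisor s \<and> q * to_total_quotient s = to_total_quotient a"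
proof transfer
  fix q :: "'a \<times> 'a"
  assume q: "tqrel q q"
  show "\<exists>a s. nonzerodivisor s \<and> tqrel (fst q * fst (s, 1), snd q * snd (s, 1)) (a, 1)"
    by (rule exI[of _ "fst q"], rule exI[of _ "snd q"])
      (use q in \<open>simp add: tqrel_def\<close>)
qed


subsection \<open>Rings containing the rationals\<close>

definition contains_rat :: "'a::comm_ring_1 itself \<Rightarrow> bool" where
  "contains_rat _ \<longleftrightarrow> (\<exists>h :: rat \<Rightarrow> 'a. inj h \<and> h 1 = 1 \<and>
     (\<forall>x y. h (x + y) = h x + h y) \<and> (\<forall>x y. h (x * y) = h x * h y))"

end

theory Submission
  imports Defs
begin

text \<open>
  If \<open>b = x / y\<close>, clearing denominators shows that \<open>b\<close> is a root of a monic polynomial of degree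
  \<open>m + 1\<close> iff \<open>x ^ (m + 1)\<close> lies in \<open>y (x, y) ^ m\<close>, that is, iff
  \<open>(x, y) ^ (m + 1) = y (x, y) ^ m\<close>. Hence the integral degree of \<open>b\<close> is at most
  \<open>rn (x, y) + 1\<close>.

  Conversely, let \<open>(a)\<close> be a reduction of a regular ideal \<open>I\<close>. Then \<open>a\<close> is a nonzerodivisor and
  \<open>x / a\<close> is integral for all \<open>x \<in> I\<close>. If all integral degrees are at most \<open>d\<close>, then
  \<open>x ^ d \<in> a I ^ (d - 1)\<close> for all \<open>x \<in> I\<close>. Since \<open>d!\<close> is invertible, polarization expresses any
  product of \<open>d\<close> elements of \<open>I\<close> as a combination of \<open>d\<close>-th powers of elements of \<open>I\<close>, so that
  \<open>I ^ d = a I ^ (d - 1)\<close>.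
\<close>

section \<open>Ideals and their powers\<close>

interpretation ring_module: module "(*) :: 'a::comm_ring_1 \<Rightarrow> 'a \<Rightarrow> 'a"
  by unfold_locales (simp_all add: algebra_simps)

declare ring_module.scale_scale [simp del] \<comment> \<open>it would undo \<open>mult.assoc\<close>\<close>

lemma ring_ideal_ideal_gen [simp]: "ring_ideal (ideal_gen S)"
  unfolding ring_ideal_def ideal_gen_def by simp

lemma ring_idealD:
  assumes "ring_ideal I"
  shows "0 \<in> I" "x \<in> I \<Longrightarrow> y \<in> I \<Longrightarrow> x + y \<in> I" "x \<in> I \<Longrightarrow> y \<in> I \<Longrightarrow> x - y \<in> I"
    "x \<in> I \<Longrightarrow> c * x \<in> I" "(\<And>i. i \<in> S \<Longrightarrow> f i \<in> I) \<Longrightarrow> sum f S \<in> I"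
  using assms unfolding ring_ideal_def
  by (auto intro: ring_module.subspace_0 ring_module.subspace_add ring_module.subspace_diff
      ring_module.subspace_scale ring_module.subspace_sum)

lemma ring_ideal_UNIV [simp]: "ring_ideal UNIV"
  unfolding ring_ideal_def by simp

lemma ideal_gen_superset: "x \<in> S \<Longrightarrow> x \<in> ideal_gen S"
  unfolding ideal_gen_def by (rule ring_module.span_base)

lemma ideal_gen_subsetI: "ring_ideal I \<Longrightarrow> S \<subseteq> I \<Longrightarrow> ideal_gen S \<subseteq> I"
  unfolding ideal_gen_def ring_ideal_def by (rule ring_module.span_minimal)

lemma ideal_gen_mono: "S \<subseteq> T \<Longrightarrow> ideal_gen S \<subseteq> ideal_gen T"
  unfolding ideal_gen_def by (rule ring_module.span_mono)

text \<open>This is the colon ideal (I : c). Since it is an ideal, a claim about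
  \<open>c * x\<close> has to be checked only for \<open>x\<close> in a generating set.\<close>

lemma ring_ideal_vimage_mult: "ring_ideal I \<Longrightarrow> ring_ideal {x. c * x \<in> I}"
  unfolding ring_ideal_def ring_module.subspace_def
  by (auto simp: distrib_left) (metis mult.left_commute)

lemma ring_ideal_image_mult:
  assumes "ring_ideal I"
  shows "ring_ideal ((*) c ` I)"
  unfolding ring_ideal_def
proof (rule ring_module.subspaceI)
  show "0 \<in> (*) c ` I"
    using ring_idealD(1)[OF assms] by (rule rev_image_eqI) simp
  show "x + y \<in> (*) c ` I" if "x \<in> (*) c ` I" "y \<in> (*) c ` I" for x y
    using that ring_idealD(2)[OF assms] by (auto simp flip: distrib_left)
  show "r * x \<in> (*) c ` I" if "x \<in> (*) c ` I" for r x
    using that ring_idealD(4)[OF assms] by (auto simp: mult.left_commute[of r])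
qed

lemma ideal_gen_singleton: "ideal_gen {a} = range (\<lambda>c. c * a)"
  unfolding ideal_gen_def by (rule ring_module.span_singleton)

lemma ideal_gen_1 [simp]: "ideal_gen {1} = UNIV"
  by (simp add: ideal_gen_singleton)

lemma ideal_gen_image_finite:
  assumes "finite S"
  shows "z \<in> ideal_gen (f ` S) \<longleftrightarrow> (\<exists>c. z = (\<Sum>i\<in>S. c i * f i))"
proof
  show "\<exists>c. z = (\<Sum>i\<in>S. c i * f i) \<Longrightarrow> z \<in> ideal_gen (f ` S)"
    by (auto intro!: ring_idealD(5)[OF ring_ideal_ideal_gen] ring_idealD(4)[OF ring_ideal_ideal_gen]
        intro: ideal_gen_superset)
  assume "z \<in> ideal_gen (f ` S)"
  then have "z \<in> ring_module.span (f ` S)"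
    by (simp add: ideal_gen_def)
  then show "\<exists>c. z = (\<Sum>i\<in>S. c i * f i)"
  proof (induction rule: ring_module.span_induct_alt)
    case base
    show ?case by (rule exI[of _ "\<lambda>_. 0"]) simp
  next
    case (step r x y)
    then obtain j c where j: "j \<in> S" "x = f j" and y: "y = (\<Sum>i\<in>S. c i * f i)"
      by auto
    \<comment> \<open>The value \<open>x\<close> may occur at several indices; the scalar
      \<open>r\<close> is added at the one chosen index \<open>j\<close>.\<close>
    have "(\<Sum>i\<in>S. ((if i = j then r else 0) + c i) * f i) = (\<Sum>i\<in>S. if i = j then r * f i else 0) + y"
      unfolding y sum.distrib[symmetric] by (rule sum.cong) (auto simp: distrib_right)
    also have "\<dots> = r * x + y"
      using j assms by simp
    finally show ?case by metis
  qed
qed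

section \<open>Products and powers of ideals\<close>

lemma ring_ideal_ideal_mult [simp]: "ring_ideal (ideal_mult I J)"
  by (simp add: ideal_mult_def)

lemma ring_ideal_ideal_power [simp]: "ring_ideal (ideal_power I n)"
  by (cases n) simp_all

lemma ideal_multI: "x \<in> I \<Longrightarrow> y \<in> J \<Longrightarrow> x * y \<in> ideal_mult I J"
  unfolding ideal_mult_def by (rule ideal_gen_superset) blast

lemma ideal_mult_subsetI:
  "ring_ideal K \<Longrightarrow> (\<And>x y. x \<in> I \<Longrightarrow> y \<in> J \<Longrightarrow> x * y \<in> K) \<Longrightarrow> ideal_mult I J \<subseteq> K"
  unfolding ideal_mult_def by (rule ideal_gen_subsetI) auto

lemma ideal_mult_mono: "I \<subseteq> I' \<Longrightarrow> J \<subseteq> J' \<Longrightarrow> ideal_mult I J \<subseteq> ideal_mult I' J'"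
  by (rule ideal_mult_subsetI) (auto intro: ideal_multI)

lemma ideal_power_mono: "I \<subseteq> I' \<Longrightarrow> ideal_power I n \<subseteq> ideal_power I' n"
  by (induction n) (simp_all add: ideal_mult_mono)

text \<open>Membership of products is extended from generators to the whole ideal in one factor at a
  time, each time through a colon ideal.\<close>

lemma ideal_mult_ideal_gen:
  "ideal_mult (ideal_gen S) (ideal_gen T) = ideal_gen {s * t | s t. s \<in> S \<and> t \<in> T}"
  (is "_ = ideal_gen ?P")
proof
  have "s * t \<in> ideal_gen ?P" if "s \<in> S" "t \<in> ideal_gen T" for s t
    using ideal_gen_subsetI[OF ring_ideal_vimage_mult[of "ideal_gen ?P" s], of T] that
    by (auto intro: ideal_gen_superset)
  then have "s * t \<in> ideal_gen ?P" if "s \<in> ideal_gen S" "t \<in> ideal_gen T" for s t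
    using ideal_gen_subsetI[OF ring_ideal_vimage_mult[of "ideal_gen ?P" t], of S] that
    by (auto simp: mult.commute)
  then show "ideal_mult (ideal_gen S) (ideal_gen T) \<subseteq> ideal_gen ?P"
    by (intro ideal_mult_subsetI) auto
  show "ideal_gen ?P \<subseteq> ideal_mult (ideal_gen S) (ideal_gen T)"
    by (rule ideal_gen_subsetI) (auto intro: ideal_multI ideal_gen_superset)
qed

lemma ideal_gen_ideal: "ring_ideal I \<Longrightarrow> ideal_gen I = I"
  by (simp add: ideal_gen_subsetI ideal_gen_superset subset_antisym subsetI)

text \<open>Reduction equations thereby become equations between images under multiplication by
  \<open>a\<close>, from which nonzerodivisors cancel by injectivity.\<close>

lemma ideal_mult_singleton:
  assumes "ring_ideal K"
  shows "ideal_mult (ideal_gen {a}) K = (*) a ` K"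
proof -
  have "ideal_mult (ideal_gen {a}) (ideal_gen K) = ideal_gen ((*) a ` K)"
    unfolding ideal_mult_ideal_gen by (rule arg_cong[of _ _ ideal_gen]) auto
  then show ?thesis
    using assms by (simp add: ideal_gen_ideal ring_ideal_image_mult)
qed

lemma ideal_gen_image_mult: "ideal_gen ((*) a ` S) = (*) a ` ideal_gen S"
proof
  show "ideal_gen ((*) a ` S) \<subseteq> (*) a ` ideal_gen S"
    by (rule ideal_gen_subsetI) (auto simp: ring_ideal_image_mult intro: ideal_gen_superset)
  have "ideal_gen S \<subseteq> {x. a * x \<in> ideal_gen ((*) a ` S)}"
    by (rule ideal_gen_subsetI) (auto simp: ring_ideal_vimage_mult intro: ideal_gen_superset)
  then show "(*) a ` ideal_gen S \<subseteq> ideal_gen ((*) a ` S)"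
    by auto
qed

lemma ideal_mult_image_mult: "ideal_mult I ((*) a ` K) = (*) a ` ideal_mult I K"
  unfolding ideal_mult_def ideal_gen_image_mult[symmetric]
  by (rule arg_cong[of _ _ ideal_gen]) (auto simp: image_iff; metis mult.left_commute)

lemma ideal_power_add:
  "x \<in> ideal_power I m \<Longrightarrow> y \<in> ideal_power I n \<Longrightarrow> x * y \<in> ideal_power I (m + n)"
proof (induction m arbitrary: x y)
  case 0
  then show ?case by (simp add: ring_idealD(4))
next
  case (Suc m)
  have "ideal_mult I (ideal_power I m) \<subseteq> {x. y * x \<in> ideal_power I (Suc m + n)}"
  proof (rule ideal_mult_subsetI)
    fix u v assume "u \<in> I" "v \<in> ideal_power I m"
    then have "u * (v * y) \<in> ideal_power I (Suc m + n)"
      using Suc.IH[OF _ Suc.prems(2)] by (simp add: ideal_multI)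
    then show "u * v \<in> {x. y * x \<in> ideal_power I (Suc m + n)}"
      by (simp only: mem_Collect_eq ac_simps)
  qed (simp only: ring_ideal_vimage_mult ring_ideal_ideal_power)
  then show ?case
    using Suc.prems(1) by (auto simp: mult.commute)
qed

lemma power_in_ideal_power: "x \<in> I \<Longrightarrow> x ^ n \<in> ideal_power I n"
  by (induction n) (simp_all add: ideal_multI)

text \<open>Lists of factors are the form in which polarization produces products.\<close>

lemma ideal_power_eq_ideal_gen_prod_list:
  assumes "ring_ideal I"
  shows "ideal_power I n = ideal_gen {prod_list xs | xs. length xs = n \<and> set xs \<subseteq> I}"
proof (induction n)
  case 0
  then show ?case by simp
next
  case (Suc n)
  have "ideal_power I (Suc n) =
      ideal_mult (ideal_gen I) (ideal_gen {prod_list xs | xs. length xs = n \<and> set xs \<subseteq> I})"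
    using assms by (simp add: Suc.IH ideal_gen_ideal)
  also have "\<dots> = ideal_gen {prod_list xs | xs. length xs = Suc n \<and> set xs \<subseteq> I}"
    unfolding ideal_mult_ideal_gen
    by (rule arg_cong[of _ _ ideal_gen]) (auto simp: length_Suc_conv; force)
  finally show ?case .
qed

lemma ideal_power_pair: "ideal_power (ideal_gen {x, y}) n = ideal_gen ((\<lambda>i. x ^ i * y ^ (n - i)) ` {..n})"
proof (induction n)
  case 0
  then show ?case by simp
next
  case (Suc n)
  have "{s * t | s t. s \<in> {x, y} \<and> t \<in> (\<lambda>i. x ^ i * y ^ (n - i)) ` {..n}} =
      (\<lambda>i. x ^ i * y ^ (Suc n - i)) ` {..Suc n}" (is "?L = ?R")
  proof
    show "?L \<subseteq> ?R"
    proof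
      fix z assume "z \<in> ?L"
      then obtain i where i: "i \<le> n" "z = x * (x ^ i * y ^ (n - i)) \<or> z = y * (x ^ i * y ^ (n - i))"
        by auto
      from i(2) show "z \<in> ?R"
      proof
        assume "z = x * (x ^ i * y ^ (n - i))"
        then show ?thesis
          using i(1) by (intro image_eqI[of _ _ "Suc i"]) (auto simp: ac_simps)
      next
        assume "z = y * (x ^ i * y ^ (n - i))"
        then show ?thesis
          using i(1) by (intro image_eqI[of _ _ i]) (auto simp: Suc_diff_le ac_simps)
      qed
    qed
    show "?R \<subseteq> ?L"
    proof
      fix z assume "z \<in> ?R"
      then obtain i where i: "i \<le> Suc n" and z: "z = x ^ i * y ^ (Suc n - i)"
        by auto
      show "z \<in> ?L"
      proof (cases i)
        case 0
        then have "z = y * (x ^ 0 * y ^ (n - 0))"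
          by (simp add: z)
        then show ?thesis by blast
      next
        case (Suc j)
        then have "z = x * (x ^ j * y ^ (n - j))" "j \<le> n"
          using i by (simp_all add: z ac_simps)
        then show ?thesis by blast
      qed
    qed
  qed
  then show ?case
    by (simp add: Suc.IH ideal_mult_ideal_gen)
qed

section \<open>Principal reductions\<close>

lemma nonzerodivisor_power: "nonzerodivisor x \<Longrightarrow> nonzerodivisor (x ^ n)"
  by (induction n) simp_all

lemma nonzerodivisor_factor: "nonzerodivisor (x * y) \<Longrightarrow> nonzerodivisor x"
  unfolding nonzerodivisor_def by (metis mult.assoc mult.commute mult_zero_right)

text \<open>A power of a nonzerodivisor of \<open>I\<close> lies in \<open>I ^ (n + 1)\<close>, so
  it is a multiple of \<open>a\<close>, and every factor of a nonzerodivisor is one.\<close>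

lemma principal_reduction_generator_nonzerodivisor:
  assumes "regular_ideal I" and "ideal_power I (Suc n) = (*) a ` ideal_power I n"
  shows "nonzerodivisor a"
proof -
  obtain z where "z \<in> I" and z: "nonzerodivisor z"
    using assms(1) by (auto simp: regular_ideal_def)
  then obtain w where "z ^ Suc n = a * w"
    using power_in_ideal_power[of z I "Suc n"] assms(2) by blast
  then show ?thesis
    using nonzerodivisor_power[OF z, of "Suc n"] nonzerodivisor_factor by metis
qed

lemma ideal_power_principal_reduction_add:
  assumes "ideal_power I (Suc n) = (*) a ` ideal_power I n"
  shows "ideal_power I (n + k) = (*) (a ^ k) ` ideal_power I n"
proof (induction k)
  case 0
  then show ?case by simp
next
  case (Suc k)
  have "ideal_power I (n + Suc k) = (*) (a ^ k) ` ideal_power I (Suc n)"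
    by (simp add: Suc.IH ideal_mult_image_mult)
  also have "\<dots> = (*) (a ^ Suc k) ` ideal_power I n"
    by (simp add: assms image_image ac_simps del: ideal_power.simps)
  finally show ?case .
qed

text \<open>The exponents at which the reduction equation holds do not depend on the principal
  reduction. After multiplication by \<open>a ^ m\<close> the claim lives in degree
  \<open>n + m\<close>, where the equation for \<open>b\<close> holds already; then
  \<open>a ^ m\<close> is cancelled.\<close>

lemma principal_reduction_transfer:
  assumes "regular_ideal I"
    and a: "ideal_power I (Suc n) = (*) a ` ideal_power I n"
    and b: "ideal_power I (Suc m) = (*) b ` ideal_power I m"
  shows "ideal_power I (Suc n) = (*) b ` ideal_power I n"
proof -
  have nz: "nonzerodivisor (a ^ m)"
    using principal_reduction_generator_nonzerodivisor[OF assms(1) a] by (rule nonzerodivisor_power)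
  have "(*) (a ^ m) ` ideal_power I (Suc n) = ideal_power I (Suc (n + m))"
    by (simp add: ideal_power_principal_reduction_add[OF a] ideal_mult_image_mult)
  also have "\<dots> = (*) b ` ideal_power I (n + m)"
    using ideal_power_principal_reduction_add[OF b, of "Suc n"]
      ideal_power_principal_reduction_add[OF b, of n]
    by (simp add: image_image ac_simps del: ideal_power.simps)
  also have "\<dots> = (*) (a ^ m) ` ((*) b ` ideal_power I n)"
    by (simp add: ideal_power_principal_reduction_add[OF a] image_image mult.left_commute)
  finally show ?thesis
    by (rule inj_image_eq_iff[THEN iffD1, rotated]) (use nonzerodivisor_cancel[OF nz] in \<open>auto simp: inj_def\<close>)
qed

lemma principal_reduction_of_iff:
  assumes "ring_ideal I"
  shows "principal_reduction_of J I \<longleftrightarrow>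
    (\<exists>a\<in>I. J = ideal_gen {a} \<and> (\<exists>n. ideal_power I (Suc n) = (*) a ` ideal_power I n))"
proof -
  have "ideal_gen {a} \<subseteq> I \<longleftrightarrow> a \<in> I" for a
    using ideal_gen_subsetI[OF assms, of "{a}"] ideal_gen_superset[of a "{a}"] by auto
  then have "reduction_of (ideal_gen {a}) I \<longleftrightarrow>
      a \<in> I \<and> (\<exists>n. ideal_power I (Suc n) = (*) a ` ideal_power I n)" for a
    by (simp only: reduction_of_def assms ring_ideal_ideal_gen ideal_mult_singleton
        ring_ideal_ideal_power Suc_eq_plus1 simp_thms)
  then show ?thesis
    unfolding principal_reduction_of_def by blast
qed

text \<open>By \<open>principal_reduction_transfer\<close> all principal reductions have the same
  least exponent, so the definite description in \<open>reduction_number\<close> is well defined and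
  any generator \<open>a\<close> computes it.\<close>

lemma reduction_number_eq_Least:
  assumes "regular_ideal I" and "a \<in> I" and a: "ideal_power I (Suc k) = (*) a ` ideal_power I k"
  shows "reduction_number I = (LEAST n. ideal_power I (Suc n) = (*) a ` ideal_power I n)"
    (is "_ = ?r")
proof -
  have I: "ring_ideal I"
    using assms(1) by (simp add: regular_ideal_def)
  have "reduction_number_wrt J I = ?r" if J: "principal_reduction_of J I" for J
  proof -
    obtain b m where J_eq: "J = ideal_gen {b}" and b: "ideal_power I (Suc m) = (*) b ` ideal_power I m"
      using J principal_reduction_of_iff[OF I] by auto
    have "ideal_power I (Suc n) = (*) b ` ideal_power I n \<longleftrightarrow>
        ideal_power I (Suc n) = (*) a ` ideal_power I n" for n
      using principal_reduction_transfer[OF assms(1)] a b by metis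
    then show ?thesis
      by (simp add: reduction_number_wrt_def J_eq ideal_mult_singleton del: ideal_power.simps
          flip: ideal_power.simps(2))
  qed
  moreover have "principal_reduction_of (ideal_gen {a}) I"
    using principal_reduction_of_iff[OF I] assms(2) a by blast
  ultimately show ?thesis
    unfolding reduction_number_def by (intro the_equality) auto
qed

section \<open>Integral equations of fractions\<close>

text \<open>The right side is the homogenized monic equation of degree \<open>m + 1\<close> for x /
  y. All its terms other than \<open>x ^ (m + 1)\<close> are \<open>y\<close> times a monomial of
  degree \<open>m\<close>, and these monomials generate the power.\<close>

lemma ideal_power_pair_integral_equation:
  "x ^ Suc m \<in> (*) y ` ideal_power (ideal_gen {x, y}) m \<longleftrightarrow>
    (\<exists>c. x ^ Suc m = (\<Sum>i\<le>m. c i * (x ^ i * y ^ (Suc m - i))))"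
proof -
  have "y * (\<Sum>i\<le>m. c i * (x ^ i * y ^ (m - i))) = (\<Sum>i\<le>m. c i * (x ^ i * y ^ (Suc m - i)))" for c
    by (simp add: sum_distrib_left Suc_diff_le ac_simps cong: sum.cong_simp)
  then show ?thesis
    unfolding ideal_power_pair image_iff Bex_def by (metis (no_types) finite_atMost ideal_gen_image_finite)
qed

text \<open>Among the monomials of degree \<open>m + 1\<close> in \<open>x\<close> and
  \<open>y\<close>, only \<open>x ^ (m + 1)\<close> is without a factor \<open>y\<close>.\<close>

lemma ideal_power_pair_reduction_iff:
  "ideal_power (ideal_gen {x, y}) (Suc m) = (*) y ` ideal_power (ideal_gen {x, y}) m \<longleftrightarrow>
    x ^ Suc m \<in> (*) y ` ideal_power (ideal_gen {x, y}) m" (is "?I = ?yI \<longleftrightarrow> _")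
proof
  show "x ^ Suc m \<in> ?yI" if "?I = ?yI"
    using that power_in_ideal_power[of x "ideal_gen {x, y}" "Suc m"]
    by (auto intro: ideal_gen_superset)
  assume x: "x ^ Suc m \<in> ?yI"
  show "?I = ?yI"
  proof
    show "?yI \<subseteq> ?I"
      by (auto intro!: ideal_multI ideal_gen_superset)
    have "x ^ i * y ^ (Suc m - i) \<in> ?yI" if "i \<le> Suc m" for i
    proof (cases "i = Suc m")
      case True
      then show ?thesis using x by simp
    next
      case False
      then have i: "i \<le> m" using that by simp
      then have "x ^ i * y ^ (m - i) \<in> ideal_power (ideal_gen {x, y}) m"
        unfolding ideal_power_pair by (auto intro: ideal_gen_superset)
      moreover have "x ^ i * y ^ (Suc m - i) = y * (x ^ i * y ^ (m - i))"
        using i by (simp add: Suc_diff_le ac_simps)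
      ultimately show ?thesis by blast
    qed
    then show "?I \<subseteq> ?yI"
      unfolding ideal_power_pair[of x y "Suc m"]
      by (intro ideal_gen_subsetI ring_ideal_image_mult) auto
  qed
qed

section \<open>Clearing denominators in the total quotient ring\<close>

lemma to_total_quotient_power: "to_total_quotient (x ^ n) = to_total_quotient x ^ n"
  by (induction n) (simp_all add: to_total_quotient_hom)

lemma to_total_quotient_sum: "to_total_quotient (sum f S) = (\<Sum>i\<in>S. to_total_quotient (f i))"
  by (induction S rule: infinite_finite_induct) (simp_all add: to_total_quotient_hom)

lemma to_total_quotient_mult_cancel:
  assumes "nonzerodivisor y" and "to_total_quotient y * p = to_total_quotient y * q"
  shows "p = q"
proof -
  obtain r where "1 = to_total_quotient y * r"
    using to_total_quotient_dvd_1[OF assms(1)] by (elim dvdE)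
  then show ?thesis
    using assms(2) by (metis mult.commute mult.left_commute mult_1)
qed

text \<open>With b = x / y, the factor \<open>y ^ n\<close> splits as
  \<open>y ^ i * y ^ (n - i)\<close>, and \<open>y ^ i\<close> turns \<open>b ^ i\<close> into
  \<open>x ^ i\<close>.\<close>

lemma sum_fraction_clear_denominators:
  assumes "b * to_total_quotient y = to_total_quotient x"
  shows "to_total_quotient y ^ n * (\<Sum>i\<le>n. to_total_quotient (c i) * b ^ i) =
    to_total_quotient (\<Sum>i\<le>n. c i * (x ^ i * y ^ (n - i)))"
  unfolding to_total_quotient_sum sum_distrib_left
proof (rule sum.cong)
  fix i assume "i \<in> {..n}"
  then have "to_total_quotient y ^ n = to_total_quotient y ^ i * to_total_quotient y ^ (n - i)"
    by (simp flip: power_add)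
  then show "to_total_quotient y ^ n * (to_total_quotient (c i) * b ^ i) =
      to_total_quotient (c i * (x ^ i * y ^ (n - i)))"
    by (simp add: to_total_quotient_hom to_total_quotient_power power_mult_distrib ac_simps flip: assms)
qed simp

lemma monic_root_of_degree_iff_sum:
  fixes h :: "'a::comm_ring_1 \<Rightarrow> 'b::comm_ring_1"
  assumes "h 0 = 0" and "h 1 = 1"
  shows "monic_root_of_degree h b n \<longleftrightarrow> (\<exists>c. c n = 1 \<and> (\<Sum>i\<le>n. h (c i) * b ^ i) = 0)"
proof
  assume "monic_root_of_degree h b n"
  then obtain p where p: "lead_coeff p = 1" "degree p = n" "poly (map_poly h p) b = 0"
    unfolding monic_root_of_degree_def by auto
  \<comment> \<open>The leading coefficient 1 is sent to 1, which is nonzero, so the degree is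
    preserved.\<close>
  have "degree (map_poly h p) = n"
    using p assms by (simp add: map_poly_degree_eq)
  then have "poly (map_poly h p) b = (\<Sum>i\<le>n. h (coeff p i) * b ^ i)"
    by (simp add: poly_altdef coeff_map_poly assms)
  then show "\<exists>c. c n = 1 \<and> (\<Sum>i\<le>n. h (c i) * b ^ i) = 0"
    using p by metis
next
  assume "\<exists>c. c n = 1 \<and> (\<Sum>i\<le>n. h (c i) * b ^ i) = 0"
  then obtain c where c: "c n = 1" "(\<Sum>i\<le>n. h (c i) * b ^ i) = 0"
    by auto
  define p where "p = (\<Sum>i\<le>n. monom (c i) i)"
  have coeff: "coeff p i = (if i \<le> n then c i else 0)" for i
    unfolding p_def coeff_sum by simp
  have deg: "degree p = n"
    by (rule antisym) (auto intro!: degree_le le_degree simp: coeff c)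
  have "degree (map_poly h p) = n"
    using c assms by (simp add: map_poly_degree_eq deg coeff)
  then have "poly (map_poly h p) b = 0"
    using c by (simp add: poly_altdef coeff_map_poly assms coeff)
  then show "monic_root_of_degree h b n"
    using deg coeff[of n] c unfolding monic_root_of_degree_def by auto
qed

text \<open>The image of \<open>y ^ (m + 1)\<close> is a unit and the embedding is injective, so an
  equation for \<open>b\<close> holds iff its homogenization holds in the base ring. Degree
  \<open>m + 1\<close> thus matches exponent \<open>m\<close> in the reduction equation.\<close>

lemma monic_root_of_degree_fraction_iff:
  assumes "nonzerodivisor y" and b: "b * to_total_quotient y = to_total_quotient x"
  shows "monic_root_of_degree to_total_quotient b (Suc m) \<longleftrightarrow>
    x ^ Suc m \<in> (*) y ` ideal_power (ideal_gen {x, y}) m"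
proof -
  have "(\<Sum>i\<le>Suc m. to_total_quotient (c i) * b ^ i) = 0 \<longleftrightarrow>
      (\<Sum>i\<le>Suc m. c i * (x ^ i * y ^ (Suc m - i))) = 0"
      (is "?p = 0 \<longleftrightarrow> ?s = 0") for c
  proof -
    have eq: "to_total_quotient (y ^ Suc m) * ?p = to_total_quotient ?s"
      unfolding to_total_quotient_power by (rule sum_fraction_clear_denominators[OF b])
    show ?thesis
    proof
      assume "?p = 0"
      then have "to_total_quotient ?s = to_total_quotient 0"
        using eq to_total_quotient_hom(1) by simp
      then show "?s = 0"
        by (rule injD[OF inj_to_total_quotient])
    next
      assume "?s = 0"
      then have "to_total_quotient (y ^ Suc m) * ?p = to_total_quotient (y ^ Suc m) * 0"
        using eq to_total_quotient_hom(1) by simp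
      then show "?p = 0"
        by (rule to_total_quotient_mult_cancel[OF nonzerodivisor_power[OF assms(1)]])
    qed
  qed
  then have "monic_root_of_degree to_total_quotient b (Suc m) \<longleftrightarrow>
      (\<exists>c. c (Suc m) = 1 \<and> (\<Sum>i\<le>Suc m. c i * (x ^ i * y ^ (Suc m - i))) = 0)"
    by (simp only: monic_root_of_degree_iff_sum[OF to_total_quotient_hom(1,2)])
  also have "\<dots> \<longleftrightarrow> (\<exists>c. x ^ Suc m = (\<Sum>i\<le>m. c i * (x ^ i * y ^ (Suc m - i))))"
  proof
    assume "\<exists>c. c (Suc m) = 1 \<and> (\<Sum>i\<le>Suc m. c i * (x ^ i * y ^ (Suc m - i))) = 0"
    then obtain c where "x ^ Suc m = - (\<Sum>i\<le>m. c i * (x ^ i * y ^ (Suc m - i)))"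
      by (auto simp: eq_neg_iff_add_eq_0 add.commute)
    then have "x ^ Suc m = (\<Sum>i\<le>m. - c i * (x ^ i * y ^ (Suc m - i)))"
      by (simp add: sum_negf)
    then show "\<exists>c. x ^ Suc m = (\<Sum>i\<le>m. c i * (x ^ i * y ^ (Suc m - i)))"
      by (rule exI[of _ "\<lambda>i. - c i"])
  next
    assume "\<exists>c. x ^ Suc m = (\<Sum>i\<le>m. c i * (x ^ i * y ^ (Suc m - i)))"
    then obtain c where c: "x ^ Suc m = (\<Sum>i\<le>m. c i * (x ^ i * y ^ (Suc m - i)))"
      by auto
    \<comment> \<open>Moving all terms to one side negates the lower coefficients and puts 1 at the
      top.\<close>
    have "(\<Sum>i\<le>Suc m. (if i = Suc m then 1 else - c i) * (x ^ i * y ^ (Suc m - i))) = 0"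
      using c by (simp add: sum_negf)
    then show "\<exists>c. c (Suc m) = 1 \<and> (\<Sum>i\<le>Suc m. c i * (x ^ i * y ^ (Suc m - i))) = 0"
      by (intro exI[of _ "\<lambda>i. if i = Suc m then 1 else - c i"]) simp
  qed
  finally show ?thesis
    unfolding ideal_power_pair_integral_equation .
qed

section \<open>Noetherian rings and integrality\<close>

text \<open>The ideals on the right increase with \<open>m\<close>, so any two elements of the union
  lie in a common one and the union is an ideal.\<close>

lemma ideal_gen_range_eq_Union:
  fixes c :: "nat \<Rightarrow> 'a::comm_ring_1"
  shows "ideal_gen (range c) = (\<Union>m. ideal_gen (c ` {..m}))" (is "_ = ?U")
proof
  show "?U \<subseteq> ideal_gen (range c)"
    by (intro UN_least ideal_gen_mono) auto
  have "ideal_gen (c ` {..m}) \<subseteq> ideal_gen (c ` {..n})" if "m \<le> n" for m n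
    by (rule ideal_gen_mono) (use that in auto)
  then have mono: "x \<in> ideal_gen (c ` {..m}) \<Longrightarrow> m \<le> n \<Longrightarrow> x \<in> ideal_gen (c ` {..n})" for x m n
    by blast
  have "ring_ideal ?U"
    unfolding ring_ideal_def
  proof (rule ring_module.subspaceI)
    show "0 \<in> ?U"
      by (simp add: ring_idealD(1))
    show "r * x \<in> ?U" if "x \<in> ?U" for r x
      using that ring_idealD(4)[OF ring_ideal_ideal_gen] by blast
    fix x y assume "x \<in> ?U" "y \<in> ?U"
    then obtain m n where "x \<in> ideal_gen (c ` {..m})" "y \<in> ideal_gen (c ` {..n})"
      by auto
    then have "x + y \<in> ideal_gen (c ` {..max m n})"
      by (intro ring_idealD(2)[OF ring_ideal_ideal_gen]) (auto intro: mono)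
    then show "x + y \<in> ?U"
      by blast
  qed
  then show "ideal_gen (range c) \<subseteq> ?U"
    by (rule ideal_gen_subsetI) (auto intro: ideal_gen_superset)
qed

text \<open>A finite generating set of the ideal of all terms already lies in the ideal of the first
  few. The conclusion expresses one term by its predecessors, which is the shape of a monic
  relation.\<close>

lemma noetherian_sequence:
  fixes c :: "nat \<Rightarrow> 'a::comm_ring_1"
  assumes "noetherian_type TYPE('a)"
  obtains m where "c (Suc m) \<in> ideal_gen (c ` {..m})"
proof -
  obtain F where F: "finite F" "ideal_gen (range c) = ideal_gen F"
    using assms unfolding noetherian_type_def by (metis ring_ideal_ideal_gen)
  then have F_Union: "F \<subseteq> (\<Union>m. ideal_gen (c ` {..m}))"
    using ideal_gen_superset by (auto simp flip: ideal_gen_range_eq_Union)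
  have "\<exists>m. F \<subseteq> ideal_gen (c ` {..m})"
    using F(1) F_Union
  proof (induction F rule: finite_induct)
    case (insert x F)
    then obtain m n where "F \<subseteq> ideal_gen (c ` {..m})" "x \<in> ideal_gen (c ` {..n})"
      by auto
    moreover have "ideal_gen (c ` {..k}) \<subseteq> ideal_gen (c ` {..max m n})" if "k \<le> max m n" for k
      by (rule ideal_gen_mono) (use that in auto)
    ultimately have "insert x F \<subseteq> ideal_gen (c ` {..max m n})"
      by (meson insert_subsetI max.cobounded1 max.cobounded2 subset_trans subsetD)
    then show ?case ..
  qed simp
  then obtain m where "F \<subseteq> ideal_gen (c ` {..m})" ..
  then have "ideal_gen (range c) \<subseteq> ideal_gen (c ` {..m})"
    unfolding F(2) by (rule ideal_gen_subsetI[OF ring_ideal_ideal_gen])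
  then show ?thesis
    by (intro that[of m]) (auto intro: ideal_gen_superset)
qed

text \<open>All powers of x / a have the common denominator \<open>a ^ r\<close>. The numerators
  form a sequence in a noetherian ring, so one of them is a combination of earlier ones, and this is
  an integral equation for x / a.\<close>

lemma principal_reduction_integral:
  fixes I :: "'a::comm_ring_1 set"
  assumes "noetherian_type TYPE('a)" and "regular_ideal I"
    and "a \<in> I" and a: "ideal_power I (Suc r) = (*) a ` ideal_power I r" and "x \<in> I"
  obtains m where "x ^ Suc m \<in> (*) a ` ideal_power (ideal_gen {x, a}) m"
proof -
  have nz: "nonzerodivisor (a ^ r)"
    using principal_reduction_generator_nonzerodivisor[OF assms(2) a] by (rule nonzerodivisor_power)
  have "\<exists>c. x ^ m * a ^ r = a ^ m * c" for m
  proof -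
    \<comment> \<open>This power equals \<open>a ^ m\<close> times \<open>I ^ r\<close>, so the
      quotient by \<open>a ^ m\<close> can be taken in the ring.\<close>
    have "x ^ m * a ^ r \<in> ideal_power I (r + m)"
      using ideal_power_add[OF power_in_ideal_power power_in_ideal_power] assms(3,5)
      by (metis add.commute)
    then show ?thesis
      unfolding ideal_power_principal_reduction_add[OF a] by auto
  qed
  then obtain c where c: "x ^ m * a ^ r = a ^ m * c m" for m
    by metis
  obtain m where "c (Suc m) \<in> ideal_gen (c ` {..m})"
    using noetherian_sequence[OF assms(1)] .
  then obtain e where e: "c (Suc m) = (\<Sum>i\<le>m. e i * c i)"
    using ideal_gen_image_finite[of "{..m}"] by auto
  \<comment> \<open>The relation among the \<open>c i\<close> is multiplied by
    \<open>a ^ (m + 1)\<close>; rewriting \<open>a ^ i * c i\<close> back to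
    \<open>x ^ i * a ^ r\<close> exposes \<open>a ^ r\<close> on both sides.\<close>
  have "a ^ r * x ^ Suc m = (\<Sum>i\<le>m. e i * (a ^ Suc m * c i))"
    using c[of "Suc m"] by (simp add: e sum_distrib_left ac_simps)
  also have "\<dots> = (\<Sum>i\<le>m. e i * (a ^ r * (x ^ i * a ^ (Suc m - i))))"
  proof (rule sum.cong)
    fix i assume "i \<in> {..m}"
    then have "a ^ Suc m * c i = a ^ (Suc m - i) * (a ^ i * c i)"
      by (simp flip: mult.assoc power_add power_Suc)
    also have "\<dots> = a ^ (Suc m - i) * (x ^ i * a ^ r)"
      by (simp only: c)
    finally show "e i * (a ^ Suc m * c i) = e i * (a ^ r * (x ^ i * a ^ (Suc m - i)))"
      by (simp only: ac_simps)
  qed simp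
  also have "\<dots> = a ^ r * (\<Sum>i\<le>m. e i * (x ^ i * a ^ (Suc m - i)))"
    by (simp add: sum_distrib_left ac_simps)
  finally have "x ^ Suc m = (\<Sum>i\<le>m. e i * (x ^ i * a ^ (Suc m - i)))"
    by (rule nonzerodivisor_cancel[OF nz])
  then show ?thesis
    using that ideal_power_pair_integral_equation by metis
qed

section \<open>Polarization\<close>

text \<open>The mixed finite difference of \<open>f\<close> at \<open>x\<close> with increments
  \<open>hs\<close>. It is an integer combination of values of \<open>f\<close>, and on powers it
  acts as polarization.\<close>

primrec iterated_difference :: "'a::comm_ring_1 list \<Rightarrow> ('a \<Rightarrow> 'a) \<Rightarrow> 'a \<Rightarrow> 'a" where
  "iterated_difference [] f x = f x"
| "iterated_difference (h # hs) f x = iterated_difference hs (\<lambda>y. f (y + h) - f y) x"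

lemma iterated_difference_scaled_sum:
  "iterated_difference hs (\<lambda>y. \<Sum>i\<in>S. c i * f i y) x = (\<Sum>i\<in>S. c i * iterated_difference hs (f i) x)"
proof (induction hs arbitrary: f)
  case (Cons h hs)
  have "(\<lambda>y. (\<Sum>i\<in>S. c i * f i (y + h)) - (\<Sum>i\<in>S. c i * f i y)) =
      (\<lambda>y. \<Sum>i\<in>S. c i * (f i (y + h) - f i y))"
    by (simp add: sum_subtractf right_diff_distrib)
  then show ?case
    by (simp add: Cons.IH)
qed simp

text \<open>Each difference lowers the degree: \<open>(y + h) ^ k - y ^ k\<close> has leading term
  \<open>k * h * y ^ (k - 1)\<close>. After as many steps as the degree, the factors k, k - 1, ...
  have accumulated to \<open>fact k\<close>.\<close>

lemma iterated_difference_power: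
  fixes x :: "'a::comm_ring_1"
  shows "k \<le> length hs \<Longrightarrow> iterated_difference hs (\<lambda>y. y ^ k) x =
    (if k = length hs then of_nat (fact k) * prod_list hs else 0)"
proof (induction hs arbitrary: k)
  case (Cons h hs)
  have "(y + h) ^ k = (\<Sum>i<Suc k. of_nat (k choose i) * y ^ i * h ^ (k - i))" for y :: 'a
    by (simp only: binomial_ring lessThan_Suc_atMost)
  then have "(y + h) ^ k - y ^ k = (\<Sum>i<k. (of_nat (k choose i) * h ^ (k - i)) * y ^ i)" for y :: 'a
    by (simp add: mult.commute mult.left_commute)
  then have "iterated_difference (h # hs) (\<lambda>y. y ^ k) x =
      (\<Sum>i<k. (of_nat (k choose i) * h ^ (k - i)) * iterated_difference hs (\<lambda>y. y ^ i) x)"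
    by (simp add: iterated_difference_scaled_sum)
  \<comment> \<open>Here \<open>i < k\<close> and \<open>k\<close> is at most
    \<open>length hs + 1\<close>, so the induction hypothesis applies to every \<open>i\<close>; a
    term survives only if \<open>k = length hs + 1\<close>, for \<open>i = k - 1\<close>.\<close>
  also have "\<dots> = (\<Sum>i<k. if i = length hs
      then of_nat (k choose i) * h ^ (k - i) * (of_nat (fact i) * prod_list hs) else 0)"
    using Cons by (intro sum.cong) auto
  also have "\<dots> = (if k = length (h # hs) then of_nat (fact k) * prod_list (h # hs) else 0)"
    using Cons.prems by (auto simp: algebra_simps)
  finally show ?case .
qed simp

text \<open>Every point at which \<open>f\<close> is evaluated is \<open>x\<close> plus a sum of
  entries of \<open>hs\<close>, hence in \<open>I\<close>.\<close>

lemma iterated_difference_in_ideal: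
  assumes "ring_ideal N" and "ring_ideal I" and "set hs \<subseteq> I" and "x \<in> I"
    and "\<And>y. y \<in> I \<Longrightarrow> f y \<in> N"
  shows "iterated_difference hs f x \<in> N"
  using assms(3-) by (induction hs arbitrary: f) (simp_all add: ring_idealD[OF assms(1)] ring_idealD[OF assms(2)])

lemma contains_rat_of_nat_unit:
  assumes "contains_rat TYPE('a::comm_ring_1)" and "n > 0"
  obtains u :: "'a::comm_ring_1" where "u * of_nat n = 1"
proof -
  obtain h :: "rat \<Rightarrow> 'a" where h: "h 1 = 1" "\<And>x y. h (x + y) = h x + h y" "\<And>x y. h (x * y) = h x * h y"
    using assms(1) unfolding contains_rat_def by blast
  have "h 0 = 0"
    using h(2)[of 0 0] by simp
  then have "h (of_nat n) = of_nat n" for n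
    by (induction n) (simp_all add: h)
  then have "h (1 / of_nat n) * of_nat n = 1"
    using h(3)[of "1 / of_nat n" "of_nat n"] assms(2) h(1) by simp
  then show ?thesis ..
qed

text \<open>Polarization: \<open>fact n\<close> times a product of \<open>n\<close> elements of
  \<open>I\<close> is an iterated difference of n-th powers of elements of \<open>I\<close>, and
  \<open>fact n\<close> is a unit.\<close>

lemma ideal_power_subset_of_powers:
  fixes I :: "'a::comm_ring_1 set"
  assumes "contains_rat TYPE('a)" and "ring_ideal I" and "ring_ideal N"
    and "\<And>x. x \<in> I \<Longrightarrow> x ^ n \<in> N"
  shows "ideal_power I n \<subseteq> N"
proof -
  obtain u :: 'a where u: "u * of_nat (fact n) = 1"
    using contains_rat_of_nat_unit[OF assms(1), of "fact n"] by auto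
  have "prod_list xs \<in> N" if "length xs = n" "set xs \<subseteq> I" for xs
  proof -
    have "of_nat (fact n) * prod_list xs = iterated_difference xs (\<lambda>y. y ^ n) 0"
      using that(1) by (simp add: iterated_difference_power)
    also have "\<dots> \<in> N"
      using assms that by (intro iterated_difference_in_ideal[of N I]) (auto intro: ring_idealD)
    finally have "u * (of_nat (fact n) * prod_list xs) \<in> N"
      by (rule ring_idealD(4)[OF assms(3)])
    then show ?thesis
      by (simp add: u flip: mult.assoc)
  qed
  then show ?thesis
    unfolding ideal_power_eq_ideal_gen_prod_list[OF assms(2)]
    by (intro ideal_gen_subsetI[OF assms(3)]) auto
qed

section \<open>Integral degree and reduction numbers\<close>

lemma integral_over_fraction_iff:
  assumes "nonzerodivisor y" and "b * to_total_quotient y = to_total_quotient x"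
  shows "integral_over to_total_quotient b \<longleftrightarrow>
    (\<exists>m. x ^ Suc m \<in> (*) y ` ideal_power (ideal_gen {x, y}) m)"
proof -
  have "integral_over to_total_quotient b \<longleftrightarrow> (\<exists>m. monic_root_of_degree to_total_quotient b (Suc m))"
    unfolding integral_over_def One_nat_def Suc_le_eq by (metis gr0_conv_Suc)
  then show ?thesis
    by (simp only: monic_root_of_degree_fraction_iff[OF assms])
qed

lemma integral_degree_properties:
  assumes "integral_over h b"
  shows "integral_degree h b \<ge> 1" "monic_root_of_degree h b (integral_degree h b)"
  using LeastI_ex[of "\<lambda>n. n \<ge> 1 \<and> monic_root_of_degree h b n"] assms
  by (auto simp: integral_over_def integral_degree_def)

text \<open>For b = x / y take I = (x, y). Monic equations of degree \<open>m + 1\<close> for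
  \<open>b\<close> correspond to reduction equations for (y) at exponent \<open>m\<close>, and one
  holds at \<open>reduction_number I\<close>.\<close>

lemma integral_degree_le_reduction_number:
  fixes b :: "'a::comm_ring_1 total_quotient"
  assumes "integral_over to_total_quotient b"
  obtains I :: "'a set" where "regular_ideal I" "\<exists>J. principal_reduction_of J I"
    "integral_degree to_total_quotient b \<le> Suc (reduction_number I)"
proof -
  obtain x y :: 'a where y: "nonzerodivisor y" and b: "b * to_total_quotient y = to_total_quotient x"
    using total_quotient_fraction by blast
  define I where "I = ideal_gen {x, y}"
  have I: "y \<in> I" "regular_ideal I"
    using y by (auto simp: I_def regular_ideal_def intro: ideal_gen_superset)
  have iff: "monic_root_of_degree to_total_quotient b (Suc m) \<longleftrightarrow>
      ideal_power I (Suc m) = (*) y ` ideal_power I m" for m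
    using monic_root_of_degree_fraction_iff[OF y b] ideal_power_pair_reduction_iff
    unfolding I_def by metis
  obtain k where k: "ideal_power I (Suc k) = (*) y ` ideal_power I k"
    using assms integral_over_fraction_iff[OF y b] ideal_power_pair_reduction_iff
    unfolding I_def by metis
  have "ideal_power I (Suc (reduction_number I)) = (*) y ` ideal_power I (reduction_number I)"
    unfolding reduction_number_eq_Least[OF I(2,1) k] using k by (rule LeastI)
  then have "monic_root_of_degree to_total_quotient b (Suc (reduction_number I))"
    by (simp only: iff)
  then have "integral_degree to_total_quotient b \<le> Suc (reduction_number I)"
    unfolding integral_degree_def by (intro Least_le) simp
  moreover have "\<exists>J. principal_reduction_of J I"
    using principal_reduction_of_iff[of I "ideal_gen {y}"] I k unfolding regular_ideal_def by blast
  ultimately show ?thesis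
    using that I(2) by blast
qed

text \<open>The integral equations of the fractions x / a, for \<open>x\<close> in \<open>I\<close>,
  put all powers \<open>x ^ (d + 1)\<close> into \<open>a\<close> times \<open>I ^ d\<close>;
  polarization then captures all of \<open>I ^ (d + 1)\<close>.\<close>

lemma reduction_number_le_integral_degree_bound:
  fixes I :: "'a::comm_ring_1 set"
  assumes "noetherian_type TYPE('a)" and "contains_rat TYPE('a)"
    and "regular_ideal I" and "principal_reduction_of J I"
    and bound: "\<And>b :: 'a total_quotient. integral_over to_total_quotient b \<Longrightarrow>
      integral_degree to_total_quotient b \<le> Suc d"
  shows "reduction_number I \<le> d"
proof -
  have I: "ring_ideal I"
    using assms(3) by (simp add: regular_ideal_def)
  obtain a r where a: "a \<in> I" "ideal_power I (Suc r) = (*) a ` ideal_power I r"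
    using assms(4) principal_reduction_of_iff[OF I] by auto
  have nz: "nonzerodivisor a"
    using principal_reduction_generator_nonzerodivisor assms(3) a(2) .
  have "x ^ Suc d \<in> (*) a ` ideal_power I d" if x: "x \<in> I" for x
  proof -
    obtain q where q: "1 = to_total_quotient a * q"
      using to_total_quotient_dvd_1[OF nz] by (elim dvdE)
    have "(to_total_quotient x * q) * to_total_quotient a = to_total_quotient x * (to_total_quotient a * q)"
      by (simp only: ac_simps)
    then have b: "(to_total_quotient x * q) * to_total_quotient a = to_total_quotient x"
      by (simp flip: q)
    obtain k where "x ^ Suc k \<in> (*) a ` ideal_power (ideal_gen {x, a}) k"
      using principal_reduction_integral[OF assms(1,3) a x] .
    \<comment> \<open>Integrality comes first, because only for integral elements is
      \<open>integral_degree\<close> the degree of an actual equation.\<close>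
    then have int: "integral_over to_total_quotient (to_total_quotient x * q)"
      using integral_over_fraction_iff[OF nz b] by blast
    obtain m where m: "integral_degree to_total_quotient (to_total_quotient x * q) = Suc m"
      using integral_degree_properties(1)[OF int] not0_implies_Suc by fastforce
    then have "m \<le> d"
      using bound[OF int] by simp
    have "x ^ Suc m \<in> (*) a ` ideal_power (ideal_gen {x, a}) m"
      using integral_degree_properties(2)[OF int] monic_root_of_degree_fraction_iff[OF nz b] m by metis
    moreover have "ideal_power (ideal_gen {x, a}) m \<subseteq> ideal_power I m"
      using x a(1) I by (intro ideal_power_mono ideal_gen_subsetI) auto
    ultimately obtain w where w: "w \<in> ideal_power I m" "x ^ Suc m = a * w"
      by auto
    \<comment> \<open>The exponent \<open>m\<close> depends on \<open>x\<close>; multiplying by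
      \<open>x ^ (d - m)\<close> brings all \<open>x\<close> to the common exponent
      \<open>d + 1\<close>.\<close>
    have "x ^ Suc d = x ^ Suc m * x ^ (d - m)"
      using \<open>m \<le> d\<close> by (simp flip: power_add power_Suc)
    also have "\<dots> = a * (w * x ^ (d - m))"
      by (simp only: w mult.assoc)
    finally show ?thesis
      using ideal_power_add[OF w(1) power_in_ideal_power[OF x], of "d - m"] \<open>m \<le> d\<close> by auto
  qed
  then have "ideal_power I (Suc d) \<subseteq> (*) a ` ideal_power I d"
    by (intro ideal_power_subset_of_powers[OF assms(2) I] ring_ideal_image_mult) auto
  moreover have "(*) a ` ideal_power I d \<subseteq> ideal_power I (Suc d)"
    using a(1) by (auto intro: ideal_multI)
  ultimately show ?thesis
    unfolding reduction_number_eq_Least[OF assms(3) a] by (intro Least_le) auto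
qed

theorem theorem7p1:
  assumes "noetherian_type TYPE('a::comm_ring_1)"
    and "contains_rat TYPE('a)"
  shows "extension_integral_degree to_total_quotient
           (integral_closure (to_total_quotient :: 'a \<Rightarrow> 'a total_quotient)) =
         (SUP I \<in> {I :: 'a set. regular_ideal I \<and> (\<exists>J. principal_reduction_of J I)}.
            enat (reduction_number I)) + 1"
    (is "?D = ?S + 1")
proof (rule antisym)
  have le_D: "enat (integral_degree to_total_quotient b) \<le> ?D"
    if "integral_over to_total_quotient b" for b :: "'a total_quotient"
    unfolding extension_integral_degree_def
    by (rule SUP_upper) (use that in \<open>simp add: integral_closure_def\<close>)
  show "?D \<le> ?S + 1"
    unfolding extension_integral_degree_def
  proof (rule SUP_least)
    fix b :: "'a total_quotient"
    assume "b \<in> integral_closure to_total_quotient"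
    then have "integral_over to_total_quotient b"
      by (simp add: integral_closure_def)
    then obtain I :: "'a set" where I: "regular_ideal I" "\<exists>J. principal_reduction_of J I"
      "integral_degree to_total_quotient b \<le> Suc (reduction_number I)"
      by (rule integral_degree_le_reduction_number)
    have "enat (integral_degree to_total_quotient b) \<le> enat (reduction_number I) + 1"
      using I(3) by (simp add: one_enat_def)
    also have "\<dots> \<le> ?S + 1"
      using I by (intro add_right_mono SUP_upper) auto
    finally show "enat (integral_degree to_total_quotient b) \<le> ?S + 1" .
  qed
  show "?S + 1 \<le> ?D"
  proof (cases ?D)
    case infinity
    then show ?thesis by simp
  next
    case (enat n)
    \<comment> \<open>As a root of X, \<open>0\<close> is integral, and its integral degree is at
      least 1. So \<open>?D\<close> is a successor and 1 can be subtracted.\<close>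
    have int: "integral_over to_total_quotient (0 :: 'a total_quotient)"
      unfolding integral_over_def monic_root_of_degree_def
      by (intro exI[of _ 1] conjI exI[of _ "[:0, 1:]"])
        (simp_all add: map_poly_pCons to_total_quotient_hom)
    have "n \<noteq> 0"
      using le_D[OF int] integral_degree_properties(1)[OF int] enat by auto
    then obtain d where n: "n = Suc d"
      using not0_implies_Suc by blast
    have "?S \<le> enat d"
    proof (rule SUP_least)
      fix I :: "'a set"
      assume "I \<in> {I. regular_ideal I \<and> (\<exists>J. principal_reduction_of J I)}"
      then obtain J where IJ: "regular_ideal I" "principal_reduction_of J I"
        by auto
      have "integral_degree to_total_quotient b \<le> Suc d"
        if "integral_over to_total_quotient b" for b :: "'a total_quotient"
        using le_D[OF that] enat n by simp
      then show "enat (reduction_number I) \<le> enat d"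
        using reduction_number_le_integral_degree_bound[OF assms IJ] by simp
    qed
    then have "?S + 1 \<le> enat d + 1"
      by (rule add_right_mono)
    then show ?thesis
      by (simp add: enat n one_enat_def)
  qed
qed

end
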